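(* Suppose $f:\mathcal{X}\to\mathbb{R}$ is convex and $(r,\ell)$-smooth. Let $x_0\in\mathcal{X}$, denote $G:=\|\nabla f(x_0)\|$ and $L:=\ell(G)$, and let $0<\eta\le\min\left\{\frac{1}{L},\frac{r(G)}{2G}\right\}$. Then the gradient descent iterates $x_{t+1}=x_t-\eta\nabla f(x_t)$ satisfy $\|\nabla f(x_t)\|\le G$ for all $t\ge 0$, and for every integer $T\ge 1$ $$f(x_T)-f^*\le\frac{\|x_0-x^*\|^2}{2\eta T}.$$
   Context: $\mathcal{X}\subseteq\mathbb{R}^d$ is the domain of $f$; $\|\cdot\|$ is the Euclidean norm. Standing assumptions: (1) $\mathcal{X}$ is open, $f$ is differentiable on $\mathcal{X}$ and closed, i.e. for each $a\in\mathbb{R}$ the sub-level set $\{x\in\mathcal{X}: f(x)\le a\}$ is closed (in $\mathbb{R}^d$); (2) $f^*:=\inf_{x\in\mathcal{X}}f(x)>-\infty$; (3) there is a point $x^*\in\mathcal{X}$ with $f(x^* )=f^*$. Convexity: $f$ is convex if $\mathcal{X}$ is a convex set and $f(y)-f(x)\ge\langle\nabla f(x),y-x\rangle$ for all $x,y\in\mathcal{X}$. $(r,\ell)$-smoothness: let $r,\ell:[0,+\infty)\to(0,+\infty)$ be continuous, with $\ell$ non-decreasing and $r$ non-increasing, and let $\mathcal{B}(x,R)$ be the closed Euclidean ball of radius $R$ centered at $x$. A differentiable $f:\mathcal{X}\to\mathbb{R}$ is $(r,\ell)$-smooth if 1) for any $x\in\mathcal{X}$, $\mathcal{B}(x,r(\|\nabla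 f(x)\|))\subseteq\mathcal{X}$, and 2) for any $x\in\mathcal{X}$ and any $x_1,x_2\in\mathcal{B}(x,r(\|\nabla f(x)\|))$, $\|\nabla f(x_1)-\nabla f(x_2)\|\le\ell(\|\nabla f(x)\|)\cdot\|x_1-x_2\|$. Conventions: $r(G)/(2G)=+\infty$ if $G=0$. The assertion about the iterates includes that they remain in $\mathcal{X}$, so that the recursion is well defined. *)

theory Defs
  imports "HOL-Analysis.Analysis"
begin

text \<open>Functions on a domain \<open>X\<close> are total functions together with the set \<open>X\<close>. All uses below are for
  open \<open>X\<close> and \<open>f\<close> differentiable on \<open>X\<close>, so that at points of \<open>X\<close> the gradient exists and depends
  only on the values of \<open>f\<close> on \<open>X\<close>.\<close>

definition gradient :: "('a::euclidean_space \<Rightarrow> real) \<Rightarrow> 'a \<Rightarrow> 'a" where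
  "gradient f x = (THE D. GDERIV f x :> D)"

lemma gradient_eqI:
  assumes "GDERIV f x :> D"
  shows "gradient f x = D"
  unfolding gradient_def
proof (rule the_equality)
  show "GDERIV f x :> D" by (rule assms)
  fix D' assume "GDERIV f x :> D'"
  then have "(\<lambda>h. h \<bullet> D') = (\<lambda>h. h \<bullet> D)"
    using assms unfolding gderiv_def by (rule has_derivative_unique)
  then have "\<forall>h. h \<bullet> D' = h \<bullet> D"
    by (simp add: fun_eq_iff)
  then show "D' = D"
    by (simp only: vector_eq_ldot)
qed

lemma GDERIV_gradient:
  assumes "f differentiable (at x)"
  shows "GDERIV f x :> gradient f x"
proof -
  obtain f' where f': "(f has_derivative f') (at x)"
    using assms unfolding differentiable_def by blast
  then have "linear f'" by (rule has_derivative_linear)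
  then have eq: "f' h = h \<bullet> adjoint f' 1" for h
    using adjoint_works[of f' h 1] by simp
  have D: "GDERIV f x :> adjoint f' 1"
    unfolding gderiv_def by (rule has_derivative_eq_rhs[OF f']) (rule ext, rule eq)
  show ?thesis
    unfolding gradient_eqI[OF D] by (rule D)
qed

definition grad_convex_on :: "'a::euclidean_space set \<Rightarrow> ('a \<Rightarrow> real) \<Rightarrow> bool" where
  "grad_convex_on X f \<longleftrightarrow>
     convex X \<and> (\<forall>x\<in>X. \<forall>y\<in>X. f y - f x \<ge> gradient f x \<bullet> (y - x))"

text \<open>\<open>r\<close> and \<open>l\<close> stand for functions from \<open>[0,\<infinity>)\<close> to \<open>(0,\<infinity>)\<close>; their values at
  negative arguments are unconstrained and never used.\<close>

definition smoothness_pair :: "(real \<Rightarrow> real) \<Rightarrow> (real \<Rightarrow> real) \<Rightarrow> bool" where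
  "smoothness_pair r l \<longleftrightarrow>
     (\<forall>u\<ge>0. r u > 0) \<and> (\<forall>u\<ge>0. l u > 0) \<and>
     continuous_on {0..} r \<and> continuous_on {0..} l \<and>
     antimono_on {0..} r \<and> mono_on {0..} l"

definition rl_smooth_on ::
    "(real \<Rightarrow> real) \<Rightarrow> (real \<Rightarrow> real) \<Rightarrow> 'a::euclidean_space set \<Rightarrow> ('a \<Rightarrow> real) \<Rightarrow> bool" where
  "rl_smooth_on r l X f \<longleftrightarrow>
     f differentiable_on X \<and>
     (\<forall>x\<in>X. cball x (r (norm (gradient f x))) \<subseteq> X) \<and>
     (\<forall>x\<in>X. \<forall>x1 \<in> cball x (r (norm (gradient f x))). \<forall>x2 \<in> cball x (r (norm (gradient f x))).
        norm (gradient f x1 - gradient f x2) \<le> l (norm (gradient f x)) * norm (x1 - x2))"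

text \<open>The case distinction implements the convention \<open>r(G) / (2 G) = +\<infinity>\<close> for \<open>G = 0\<close>
  (in HOL the quotient would be \<open>0\<close>).\<close>

definition max_step :: "(real \<Rightarrow> real) \<Rightarrow> real \<Rightarrow> real \<Rightarrow> real" where
  "max_step r L G = (if G = 0 then 1 / L else min (1 / L) (r G / (2 * G)))"

end

theory Submission
  imports Defs
begin

text \<open>Convexity makes \<open>\<parallel>\<nabla>f\<parallel>\<close> non-increasing along gradient descent, so the
  local smoothness constants at \<open>x\<^sub>0\<close> stay valid at every iterate. To see this, let \<open>c\<close> be a point
  with \<open>\<parallel>\<nabla>f(c)\<parallel> \<le> G\<close>. As \<open>r\<close> is non-increasing and \<open>l\<close> is non-decreasing, \<open>\<nabla>f\<close> is
  \<open>L\<close>-Lipschitz on the ball of radius \<open>r(G)\<close> around \<open>c\<close>, and the step bound \<open>\<eta> \<le> r(G)/(2G)\<close> keeps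
  the next iterate \<open>y\<close> in the ball of half that radius.

  The factor \<open>2\<close> makes room for co-coercivity. For a globally smooth convex function,
  \<open>\<langle>\<nabla>f(y) - \<nabla>f(c), y - c\<rangle> \<ge> \<parallel>\<nabla>f(y) - \<nabla>f(c)\<parallel>\<^sup>2 / L\<close> is proved by comparing the quadratic upper
  bound with the tangent lower bound at the auxiliary points
  \<open>y - (\<nabla>f(y) - \<nabla>f(c)) / L\<close> and \<open>c + (\<nabla>f(y) - \<nabla>f(c)) / L\<close>. By the Lipschitz property both are
  displaced by at most \<open>\<parallel>y - c\<parallel> \<le> r(G)/2\<close>, so they remain in the ball and the global argument works
  locally (\<open>cocoercive_half_ball\<close>). Since \<open>y - c = -\<eta> \<nabla>f(c)\<close> and \<open>\<eta> \<le> 1/L\<close>, co-coercivity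
  yields \<open>\<parallel>\<nabla>f(y)\<parallel> \<le> \<parallel>\<nabla>f(c)\<parallel>\<close> (\<open>norm_gradient_step_le\<close>), and the bound by \<open>G\<close> propagates.

  The rate is then the classical one: the quadratic upper bound and convexity bound
  \<open>2\<eta> (f(x\<^sub>t\<^sub>+\<^sub>1) - f\<^sup>*)\<close> by the decrease of the squared distance to \<open>x\<^sup>*\<close>
  (\<open>gradient_step_gap\<close>), these bounds telescope, and \<open>f(x\<^sub>t)\<close> is non-increasing.\<close>

section \<open>Convex functions with locally Lipschitz gradient\<close>

lemma grad_convex_onD:
  assumes "grad_convex_on X f" "x \<in> X" "y \<in> X"
  shows "f x + gradient f x \<bullet> (y - x) \<le> f y"
  using assms by (force simp: grad_convex_on_def)

text \<open>Along the segment from \<open>x\<close> to \<open>y\<close>, the difference of the two sides has derivative of constant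
  sign, by the Lipschitz property and Cauchy-Schwarz. Only the segment matters, hence any
  convex set will do in place of the whole space.\<close>

lemma quadratic_upper_bound:
  fixes f :: "'a::euclidean_space \<Rightarrow> real"
  assumes S: "convex S" and diff: "\<And>u. u \<in> S \<Longrightarrow> f differentiable (at u)"
    and lip: "L-lipschitz_on S (gradient f)"
    and x: "x \<in> S" and y: "y \<in> S"
  shows "f y \<le> f x + gradient f x \<bullet> (y - x) + L / 2 * (norm (y - x))\<^sup>2"
proof -
  define h where "h = y - x"
  define \<phi> where "\<phi> t = f (x + t *\<^sub>R h) - t * (gradient f x \<bullet> h) - L / 2 * t\<^sup>2 * (norm h)\<^sup>2"
    for t :: real
  have "\<phi> 1 \<le> \<phi> 0"
  proof (rule DERIV_nonpos_imp_nonincreasing[where f = \<phi>])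
    fix t :: real assume t: "0 \<le> t" "t \<le> 1"
    define u where "u = x + t *\<^sub>R h"
    have "u = (1 - t) *\<^sub>R x + t *\<^sub>R y"
      by (simp add: u_def h_def algebra_simps)
    then have u: "u \<in> S"
      using S x y t by (simp add: convex_alt)
    have "(f has_derivative (\<lambda>k. k \<bullet> gradient f u)) (at u)"
      using GDERIV_gradient[OF diff[OF u]] by (simp add: gderiv_def)
    then have df: "(f has_derivative (\<lambda>k. k \<bullet> gradient f u)) (at (x + t *\<^sub>R h))"
      by (simp add: u_def)
    have "((\<lambda>t. f (x + t *\<^sub>R h)) has_derivative (\<lambda>s. (s *\<^sub>R h) \<bullet> gradient f u)) (at t)"
      by (rule has_derivative_compose[where f = "\<lambda>t. x + t *\<^sub>R h" and g = f, OF _ df])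
        (auto intro!: derivative_eq_intros)
    then have df': "((\<lambda>t. f (x + t *\<^sub>R h)) has_real_derivative gradient f u \<bullet> h) (at t)"
      unfolding has_field_derivative_def
      by (rule has_derivative_eq_rhs) (auto simp: inner_commute)
    have D: "(\<phi> has_real_derivative
        gradient f u \<bullet> h - gradient f x \<bullet> h - L * t * (norm h)\<^sup>2) (at t)"
      unfolding \<phi>_def by (auto intro!: derivative_eq_intros df')
    have "(gradient f u - gradient f x) \<bullet> h \<le> norm (gradient f u - gradient f x) * norm h"
      by (rule norm_cauchy_schwarz)
    also have "\<dots> \<le> (L * (t * norm h)) * norm h"
      using lipschitz_onD[OF lip u x] t
      by (intro mult_right_mono) (auto simp: dist_norm u_def)
    finally have "gradient f u \<bullet> h - gradient f x \<bullet> h - L * t * (norm h)\<^sup>2 \<le> 0"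
      by (simp add: inner_diff_left power2_eq_square algebra_simps)
    with D show "\<exists>D. (\<phi> has_real_derivative D) (at t) \<and> D \<le> 0" by blast
  qed simp
  then show ?thesis by (simp add: \<phi>_def h_def)
qed

text \<open>The auxiliary point \<open>z = y - (\<nabla>f(y) - \<nabla>f(x)) / L\<close> minimises, over its displacement from
  \<open>y\<close>, the quadratic upper bound at \<open>y\<close> minus the tangent at \<open>x\<close>. That this difference is
  nonnegative at \<open>z\<close> is the assertion. The hypothesis \<open>z \<in> S\<close> is what localises the classical
  argument.\<close>

lemma gradient_difference_bound:
  fixes f :: "'a::euclidean_space \<Rightarrow> real"
  assumes cvx: "grad_convex_on X f" and "S \<subseteq> X" and L: "L > 0"
    and S: "convex S" and diff: "\<And>u. u \<in> S \<Longrightarrow> f differentiable (at u)"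
    and lip: "L-lipschitz_on S (gradient f)"
    and x: "x \<in> S" and y: "y \<in> S"
    and z: "y - (1 / L) *\<^sub>R (gradient f y - gradient f x) \<in> S"
  shows "(norm (gradient f y - gradient f x))\<^sup>2 / (2 * L) \<le> f y - f x - gradient f x \<bullet> (y - x)"
proof -
  define D where "D = gradient f y - gradient f x"
  define z where "z = y - (1 / L) *\<^sub>R D"
  have zS: "z \<in> S" using z by (simp add: z_def D_def)
  have "f x + gradient f x \<bullet> (z - x) \<le> f z"
    using grad_convex_onD[OF cvx] x zS \<open>S \<subseteq> X\<close> by blast
  also have "f z \<le> f y + gradient f y \<bullet> (z - y) + L / 2 * (norm (z - y))\<^sup>2"
    by (rule quadratic_upper_bound[OF S diff lip y zS])
  finally have *: "f x + gradient f x \<bullet> (z - x)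
      \<le> f y + gradient f y \<bullet> (z - y) + L / 2 * (norm (z - y))\<^sup>2" .
  have "z - x = (y - x) + (z - y)" by simp
  then have e1: "gradient f x \<bullet> (z - x) = gradient f x \<bullet> (y - x) + gradient f x \<bullet> (z - y)"
    by (simp only: inner_add_right)
  have "gradient f y \<bullet> (z - y) - gradient f x \<bullet> (z - y) = D \<bullet> (z - y)"
    by (simp add: D_def inner_diff_left)
  also have "\<dots> = - ((norm D)\<^sup>2 / L)"
    by (simp add: z_def power2_norm_eq_inner)
  finally have e2: "gradient f y \<bullet> (z - y) - gradient f x \<bullet> (z - y) = - ((norm D)\<^sup>2 / L)" .
  have e3: "L / 2 * (norm (z - y))\<^sup>2 = (norm D)\<^sup>2 / L / 2"
    using L by (simp add: z_def power_divide power2_eq_square)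
  have "(norm D)\<^sup>2 / L / 2 \<le> f y - f x - gradient f x \<bullet> (y - x)"
    using * e1 e2 e3 by linarith
  then show ?thesis by (simp add: D_def mult.commute)
qed

text \<open>Adding \<open>gradient_difference_bound\<close> to its instance with the two points exchanged cancels
  the function values. Halving the radius keeps both auxiliary points in the ball.\<close>

lemma cocoercive_half_ball:
  fixes f :: "'a::euclidean_space \<Rightarrow> real"
  assumes cvx: "grad_convex_on X f" and sub: "cball c R \<subseteq> X" and L: "L > 0"
    and diff: "\<And>u. u \<in> cball c R \<Longrightarrow> f differentiable (at u)"
    and lip: "L-lipschitz_on (cball c R) (gradient f)"
    and y: "y \<in> cball c (R / 2)"
  shows "(norm (gradient f y - gradient f c))\<^sup>2 / L \<le> (gradient f y - gradient f c) \<bullet> (y - c)"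
proof -
  define D where "D = gradient f y - gradient f c"
  have yc: "norm (y - c) \<le> R / 2"
    using y by (simp add: dist_norm norm_minus_commute)
  moreover have "0 \<le> norm (y - c)" by simp
  ultimately have R: "0 \<le> R" "norm (y - c) \<le> R" by linarith+
  then have cS: "c \<in> cball c R" and yS: "y \<in> cball c R"
    by (auto simp: dist_norm norm_minus_commute)
  have "norm D \<le> L * norm (y - c)"
    using lipschitz_onD[OF lip yS cS] by (simp add: D_def dist_norm)
  then have "norm ((1 / L) *\<^sub>R D) \<le> norm (y - c)"
    using L by (simp add: pos_divide_le_eq mult.commute)
  then have D: "norm ((1 / L) *\<^sub>R D) \<le> R / 2"
    using yc by linarith
  have "norm ((y - c) - (1 / L) *\<^sub>R D) \<le> R"
    using norm_triangle_ineq4[of "y - c" "(1 / L) *\<^sub>R D"] yc D by linarith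
  moreover have "dist c (y - (1 / L) *\<^sub>R D) = norm ((y - c) - (1 / L) *\<^sub>R D)"
    by (metis dist_commute dist_norm diff_diff_eq add.commute)
  ultimately have z1: "y - (1 / L) *\<^sub>R (gradient f y - gradient f c) \<in> cball c R"
    by (simp add: D_def)
  have "norm ((1 / L) *\<^sub>R D) \<le> R"
    using D R(1) by linarith
  moreover have "dist c (c - (1 / L) *\<^sub>R (gradient f c - gradient f y)) = norm ((1 / L) *\<^sub>R D)"
    unfolding D_def dist_norm by (simp add: norm_minus_commute)
  ultimately have z2: "c - (1 / L) *\<^sub>R (gradient f c - gradient f y) \<in> cball c R"
    by (simp only: mem_cball)
  have "(norm D)\<^sup>2 / (2 * L) \<le> f y - f c - gradient f c \<bullet> (y - c)"
    unfolding D_def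
    by (rule gradient_difference_bound[OF cvx sub L convex_cball diff lip cS yS z1])
  moreover have "(norm D)\<^sup>2 / (2 * L) \<le> f c - f y - gradient f y \<bullet> (c - y)"
    using gradient_difference_bound[OF cvx sub L convex_cball diff lip yS cS z2]
    by (simp add: D_def norm_minus_commute)
  moreover have "- (gradient f c \<bullet> (y - c)) - gradient f y \<bullet> (c - y) = D \<bullet> (y - c)"
    by (simp add: D_def inner_diff_left inner_diff_right)
  moreover have "(norm D)\<^sup>2 / (2 * L) + (norm D)\<^sup>2 / (2 * L) = (norm D)\<^sup>2 / L"
    using L by (simp add: field_simps)
  ultimately have "(norm D)\<^sup>2 / L \<le> D \<bullet> (y - c)" by linarith
  then show ?thesis by (simp add: D_def)
qed

section \<open>A single gradient step\<close>

text \<open>Writing \<open>g\<close> for the gradient at \<open>c\<close> and \<open>D\<close> for its change over the step, co-coercivity reads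
  \<open>\<parallel>D\<parallel>\<^sup>2 / L \<le> -\<eta> \<langle>D, g\<rangle>\<close>. Hence \<open>\<langle>D, g\<rangle> \<le> -\<parallel>D\<parallel>\<^sup>2\<close>, which outweighs the
  quadratic term in \<open>\<parallel>g + D\<parallel>\<^sup>2\<close>.\<close>

lemma norm_gradient_step_le:
  fixes f :: "'a::euclidean_space \<Rightarrow> real"
  assumes cvx: "grad_convex_on X f" and sub: "cball c R \<subseteq> X" and L: "L > 0"
    and diff: "\<And>u. u \<in> cball c R \<Longrightarrow> f differentiable (at u)"
    and lip: "L-lipschitz_on (cball c R) (gradient f)"
    and \<eta>: "0 < \<eta>" "\<eta> \<le> 1 / L" and step: "\<eta> * norm (gradient f c) \<le> R / 2"
  shows "norm (gradient f (c - \<eta> *\<^sub>R gradient f c)) \<le> norm (gradient f c)"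
proof -
  define g where "g = gradient f c"
  define y where "y = c - \<eta> *\<^sub>R g"
  define D where "D = gradient f y - g"
  have "y \<in> cball c (R / 2)"
    using step \<eta> by (simp add: y_def g_def dist_norm)
  then have "(norm D)\<^sup>2 / L \<le> D \<bullet> (y - c)"
    using cocoercive_half_ball[OF cvx sub L diff lip] by (simp add: D_def g_def)
  then have "(norm D)\<^sup>2 / L \<le> \<eta> * (- (D \<bullet> g))"
    by (simp add: y_def)
  moreover have "\<eta> * (norm D)\<^sup>2 \<le> (norm D)\<^sup>2 / L"
    using mult_right_mono[OF \<eta>(2), of "(norm D)\<^sup>2"] by simp
  ultimately have "\<eta> * (norm D)\<^sup>2 \<le> \<eta> * (- (D \<bullet> g))" by linarith
  then have "(norm D)\<^sup>2 \<le> - (D \<bullet> g)"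
    using \<eta>(1) by (simp only: mult_le_cancel_left_pos)
  moreover have "(norm (gradient f y))\<^sup>2 = (norm g)\<^sup>2 + 2 * (D \<bullet> g) + (norm D)\<^sup>2"
  proof -
    have "gradient f y = g + D" by (simp add: D_def)
    then show ?thesis
      by (simp add: power2_norm_eq_inner inner_add_left inner_add_right inner_commute)
  qed
  moreover have "0 \<le> (norm D)\<^sup>2" by simp
  ultimately have "(norm (gradient f y))\<^sup>2 \<le> (norm g)\<^sup>2" by linarith
  then show ?thesis
    by (simp add: y_def g_def)
qed

lemma gradient_step_descent:
  fixes f :: "'a::euclidean_space \<Rightarrow> real"
  assumes S: "convex S" and diff: "\<And>u. u \<in> S \<Longrightarrow> f differentiable (at u)"
    and lip: "L-lipschitz_on S (gradient f)" and L: "L > 0"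
    and c: "c \<in> S" and y: "c - \<eta> *\<^sub>R gradient f c \<in> S"
    and \<eta>: "0 < \<eta>" "\<eta> \<le> 1 / L"
  shows "f (c - \<eta> *\<^sub>R gradient f c) \<le> f c - \<eta> / 2 * (norm (gradient f c))\<^sup>2"
proof -
  define g where "g = gradient f c"
  have "f (c - \<eta> *\<^sub>R g) \<le> f c - \<eta> * (norm g)\<^sup>2 + (L * \<eta>) * (\<eta> / 2 * (norm g)\<^sup>2)"
    using quadratic_upper_bound[OF S diff lip c y]
    by (simp add: g_def power2_norm_eq_inner[symmetric] power_mult_distrib power2_eq_square[of \<eta>] mult_ac)
  moreover have "(L * \<eta>) * (\<eta> / 2 * (norm g)\<^sup>2) \<le> 1 * (\<eta> / 2 * (norm g)\<^sup>2)"
    using \<eta> L by (intro mult_right_mono) (auto simp: field_simps)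
  ultimately show ?thesis
    unfolding g_def by linarith
qed

text \<open>The descent \<open>\<eta>/2 \<parallel>\<nabla>f(c)\<parallel>\<^sup>2\<close> is exactly what absorbs the quadratic term when the
  squared distance from the new point to \<open>p\<close> is expanded.\<close>

lemma gradient_step_gap:
  fixes f :: "'a::euclidean_space \<Rightarrow> real"
  assumes cvx: "grad_convex_on X f" and "c \<in> X" "p \<in> X" and \<eta>: "0 < \<eta>"
    and desc: "f (c - \<eta> *\<^sub>R gradient f c) \<le> f c - \<eta> / 2 * (norm (gradient f c))\<^sup>2"
  shows "2 * \<eta> * (f (c - \<eta> *\<^sub>R gradient f c) - f p)
    \<le> (norm (c - p))\<^sup>2 - (norm (c - \<eta> *\<^sub>R gradient f c - p))\<^sup>2"
proof -
  define g where "g = gradient f c"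
  have "f c + g \<bullet> (p - c) \<le> f p"
    unfolding g_def by (rule grad_convex_onD[OF cvx \<open>c \<in> X\<close> \<open>p \<in> X\<close>])
  then have "f c - f p \<le> g \<bullet> (c - p)"
    by (simp add: inner_diff_right)
  with desc have "f (c - \<eta> *\<^sub>R g) - f p \<le> g \<bullet> (c - p) - \<eta> / 2 * (norm g)\<^sup>2"
    unfolding g_def by linarith
  then have "2 * \<eta> * (f (c - \<eta> *\<^sub>R g) - f p) \<le> 2 * \<eta> * (g \<bullet> (c - p) - \<eta> / 2 * (norm g)\<^sup>2)"
    using \<eta> by (intro mult_left_mono) auto
  also have "\<dots> = (norm (c - p))\<^sup>2 - (norm ((c - p) - \<eta> *\<^sub>R g))\<^sup>2"
  proof -
    have "(norm (v - \<eta> *\<^sub>R g))\<^sup>2 = (norm v)\<^sup>2 - 2 * \<eta> * (g \<bullet> v) + \<eta> * \<eta> * (norm g)\<^sup>2" for v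
      by (simp add: power2_norm_eq_inner inner_diff_left inner_diff_right inner_commute)
    from this[of "c - p"] show ?thesis
      by (simp add: right_diff_distrib)
  qed
  also have "(c - p) - \<eta> *\<^sub>R g = c - \<eta> *\<^sub>R g - p" by simp
  finally show ?thesis unfolding g_def .
qed

section \<open>Gradient descent\<close>

lemma decreasing_telescope_bound:
  fixes a d :: "nat \<Rightarrow> real"
  assumes "\<And>t. a (Suc t) \<le> a t" "\<And>t. k * a (Suc t) \<le> d t - d (Suc t)" "0 \<le> k" "\<And>t. 0 \<le> d t"
  shows "k * real T * a T \<le> d 0"
proof -
  have "k * real T * a T \<le> d 0 - d T"
  proof (induction T)
    case (Suc T)
    have "k * real T * a (Suc T) \<le> k * real T * a T"
      using assms(1,3) by (intro mult_left_mono) auto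
    with Suc assms(2)[of T] show ?case by (simp add: algebra_simps)
  qed simp
  with assms(4)[of T] show ?thesis by linarith
qed

text \<open>Monotonicity of \<open>r\<close> and \<open>l\<close> turns the smoothness data at \<open>c\<close> into data that depend on the
  bound \<open>G\<close> alone, so the same radius and constant serve all iterates.\<close>

lemma rl_smooth_on_uniform:
  fixes f :: "'a::euclidean_space \<Rightarrow> real"
  assumes "smoothness_pair r l" "rl_smooth_on r l X f" "c \<in> X" "norm (gradient f c) \<le> G"
  shows "cball c (r G) \<subseteq> X" "(l G)-lipschitz_on (cball c (r G)) (gradient f)"
proof -
  define n where "n = norm (gradient f c)"
  have n: "0 \<le> n" "n \<le> G" using assms(4) by (auto simp: n_def)
  have lG: "0 < l G" using assms(1) n by (auto simp: smoothness_pair_def)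
  have "r G \<le> r n"
    using assms(1) n by (auto simp: smoothness_pair_def intro: monotone_onD[of "{0..}" "(\<le>)" "(\<ge>)" r])
  then have sub: "cball c (r G) \<subseteq> cball c (r n)" by (rule subset_cball)
  have ln: "l n \<le> l G"
    using assms(1) n by (auto simp: smoothness_pair_def intro: mono_onD[of "{0..}" l])
  show "cball c (r G) \<subseteq> X"
    using sub assms(2,3) by (auto simp: rl_smooth_on_def n_def)
  show "(l G)-lipschitz_on (cball c (r G)) (gradient f)"
  proof (rule lipschitz_onI)
    fix u v assume "u \<in> cball c (r G)" "v \<in> cball c (r G)"
    then have "norm (gradient f u - gradient f v) \<le> l n * norm (u - v)"
      using sub assms(2,3) unfolding rl_smooth_on_def n_def by blast
    also have "\<dots> \<le> l G * norm (u - v)" using ln by (intro mult_right_mono) auto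
    finally show "dist (gradient f u) (gradient f v) \<le> l G * dist u v"
      by (simp add: dist_norm)
  qed (use lG in simp)
qed

lemma max_stepD:
  assumes "\<eta> \<le> max_step r L G" "0 \<le> G" "0 < r G"
  shows "\<eta> \<le> 1 / L" "\<eta> * G \<le> r G / 2"
  using assms by (auto simp: max_step_def field_simps split: if_splits)

theorem theorem4p2:
  fixes X :: "(real ^ 'd) set"
    and f :: "real ^ 'd \<Rightarrow> real"
    and r l :: "real \<Rightarrow> real"
    and xstar :: "real ^ 'd"
    and fstar G L \<eta> :: real
    and x :: "nat \<Rightarrow> real ^ 'd"
  assumes "open X"
    and "f differentiable_on X"
    and "\<And>a. closed {y \<in> X. f y \<le> a}"
    and "bdd_below (f ` X)"
    and "fstar = (INF y\<in>X. f y)"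
    and "xstar \<in> X" and "f xstar = fstar"
    and "grad_convex_on X f"
    and "smoothness_pair r l"
    and "rl_smooth_on r l X f"
    and "x 0 \<in> X"
    and "G = norm (gradient f (x 0))"
    and "L = l G"
    and "0 < \<eta>" and "\<eta> \<le> max_step r L G"
    and "\<And>t. x (Suc t) = x t - \<eta> *\<^sub>R gradient f (x t)"
  shows "(\<forall>t. x t \<in> X \<and> norm (gradient f (x t)) \<le> G) \<and>
    (\<forall>T::nat. T \<ge> 1 \<longrightarrow>
       f (x T) - fstar \<le> (norm (x 0 - xstar))\<^sup>2 / (2 * \<eta> * real T))"
proof -
  have diff: "f differentiable (at u)" if "u \<in> X" for u
    using assms(1,2) that by (simp add: differentiable_on_eq_differentiable_at)
  have G: "0 \<le> G" by (simp add: assms(12))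
  have L: "0 < L" and r: "0 < r G"
    using assms(9) G by (auto simp: smoothness_pair_def assms(13))
  note \<eta> = \<open>0 < \<eta>\<close> max_stepD[OF assms(15) G r]
  note cvx = assms(8)
  have one_step: "x (Suc t) \<in> X \<and> norm (gradient f (x (Suc t))) \<le> G \<and>
      f (x (Suc t)) \<le> f (x t) - \<eta> / 2 * (norm (gradient f (x t)))\<^sup>2"
    if t: "x t \<in> X" "norm (gradient f (x t)) \<le> G" for t
  proof -
    define c where "c = x t"
    define B where "B = cball c (r G)"
    have B: "B \<subseteq> X" "L-lipschitz_on B (gradient f)"
      using rl_smooth_on_uniform[OF assms(9,10) t] by (simp_all add: B_def c_def assms(13))
    have diffB: "f differentiable (at u)" if "u \<in> B" for u
      using that B(1) diff by blast
    have y: "x (Suc t) = c - \<eta> *\<^sub>R gradient f c"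
      by (simp add: c_def assms(16))
    have "\<eta> * norm (gradient f c) \<le> \<eta> * G"
      using t \<eta>(1) by (simp add: c_def)
    then have len: "\<eta> * norm (gradient f c) \<le> r G / 2"
      using \<eta>(3) by linarith
    then have "\<eta> * norm (gradient f c) \<le> r G" using r by linarith
    then have yB: "c - \<eta> *\<^sub>R gradient f c \<in> B"
      using \<eta>(1) by (simp add: B_def dist_norm)
    have cB: "c \<in> B" using r by (simp add: B_def)
    have "norm (gradient f (x (Suc t))) \<le> norm (gradient f c)"
      unfolding y
      by (rule norm_gradient_step_le[OF cvx B(1)[unfolded B_def] L diffB[unfolded B_def]
            B(2)[unfolded B_def] \<eta>(1,2) len])
    moreover have "f (x (Suc t)) \<le> f c - \<eta> / 2 * (norm (gradient f c))\<^sup>2"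
      unfolding y
      by (rule gradient_step_descent[OF _ diffB B(2) L cB yB \<eta>(1,2)]) (simp_all add: B_def)
    ultimately show ?thesis
      using t yB B(1) y by (auto simp: c_def)
  qed
  have inv: "x t \<in> X \<and> norm (gradient f (x t)) \<le> G" for t
  proof (induction t)
    case 0
    then show ?case using assms(11,12) by simp
  next
    case (Suc t)
    then show ?case using one_step by blast
  qed
  have desc: "f (x (Suc t)) \<le> f (x t) - \<eta> / 2 * (norm (gradient f (x t)))\<^sup>2" for t
    using one_step inv by blast
  have "f (x (Suc t)) \<le> f (x t)" for t
  proof -
    have "0 \<le> \<eta> / 2 * (norm (gradient f (x t)))\<^sup>2" using \<eta>(1) by simp
    with desc[of t] show ?thesis by linarith
  qed
  moreover have "2 * \<eta> * (f (x (Suc t)) - fstar)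
      \<le> (norm (x t - xstar))\<^sup>2 - (norm (x (Suc t) - xstar))\<^sup>2" for t
    using gradient_step_gap[OF cvx _ \<open>xstar \<in> X\<close> \<eta>(1), of "x t"] desc[of t] inv[of t]
    by (simp add: assms(16) \<open>f xstar = fstar\<close>)
  ultimately have "2 * \<eta> * real T * (f (x T) - fstar) \<le> (norm (x 0 - xstar))\<^sup>2" for T
    using \<eta>(1)
    by (intro decreasing_telescope_bound[where d = "\<lambda>t. (norm (x t - xstar))\<^sup>2"]) auto
  then have "f (x T) - fstar \<le> (norm (x 0 - xstar))\<^sup>2 / (2 * \<eta> * real T)" if "T \<ge> 1" for T
    using that \<eta>(1) by (simp add: pos_le_divide_eq mult.commute)
  with inv show ?thesis by blast
qed

end
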